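(* If $D$ is a $2$-acyclic multidigraph, then its tree conflict graph $G^{\mathbf{t}}_D$ is chordal.
   Context: A multidigraph $D$ consists of finite sets $V(D)$, $E(D)$ and maps $s,t:E(D)\to V(D)$ (source, target). A directed cycle is a connected multidigraph without parallel edges (two distinct edges with the same source and same target) in which every vertex has in-degree and out-degree $1$; its length is its number of vertices. $D$ is $2$-acyclic if it contains no directed cycle of length at least $3$ (directed $2$-cycles are allowed). The tree conflict graph $G^{\mathbf{t}}_D$ is the simple graph with vertex set $E(D)$ in which distinct $e,f$ are adjacent iff $t(e)=t(f)$ or $\{s(e),t(e)\}=\{s(f),t(f)\}$. A graph is chordal if it has no induced cycle of length $\ge 4$. *)

theory Defs
  imports "Graph_Theory.Graph_Theory"
begin

text \<open>
  A multidigraph is a \<open>fin_digraph\<close> of the Graph-Theory entry: finite sets of vertices and of arcs,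
  with \<open>tail\<close> as source and \<open>head\<close> as target. Loops and parallel arcs are allowed.
\<close>

text \<open>Parallel arcs are excluded by \<open>nomulti_digraph\<close>; antiparallel arcs and loops are not,
  so directed cycles of length 2 and 1 are included.\<close>

definition directed_cycle :: "('a, 'b) pre_digraph \<Rightarrow> bool" where
  "directed_cycle C \<longleftrightarrow>
     fin_digraph C \<and> nomulti_digraph C \<and> connected C \<and>
     (\<forall>v \<in> verts C. in_degree C v = 1 \<and> out_degree C v = 1)"

definition two_acyclic :: "('a, 'b) pre_digraph \<Rightarrow> bool" where
  "two_acyclic D \<longleftrightarrow>
     \<not> (\<exists>C. subgraph C D \<and> directed_cycle C \<and> card (verts C) \<ge> 3)"

text \<open>Simple graphs are represented, as in \<open>pair_graph\<close>, by a symmetric irreflexive set of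
  ordered pairs.\<close>

definition tree_conflict_graph :: "('a, 'b) pre_digraph \<Rightarrow> 'b pair_pre_digraph" where
  "tree_conflict_graph D =
     \<lparr> pverts = arcs D,
       parcs = {(e, f). e \<in> arcs D \<and> f \<in> arcs D \<and> e \<noteq> f \<and>
                 (head D e = head D f \<or> {tail D e, head D e} = {tail D f, head D f})} \<rparr>"

lemma pair_graph_tree_conflict_graph:
  assumes "fin_digraph D"
  shows "pair_graph (tree_conflict_graph D)"
proof -
  interpret fin_digraph D by fact
  have "parcs (tree_conflict_graph D) \<subseteq> arcs D \<times> arcs D"
    by (auto simp: tree_conflict_graph_def)
  then have "finite (parcs (tree_conflict_graph D))"
    by (rule finite_subset) simp
  then show ?thesis
    by unfold_locales (auto simp: tree_conflict_graph_def symmetric_def sym_def)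
qed

text \<open>The list \<open>vs\<close> enumerates the vertices of an induced cycle in cyclic order: the equivalence
  requires consecutive vertices to be adjacent and forbids chords.\<close>

definition induced_cycle :: "'a pair_pre_digraph \<Rightarrow> 'a list \<Rightarrow> bool" where
  "induced_cycle G vs \<longleftrightarrow>
     length vs \<ge> 3 \<and> distinct vs \<and> set vs \<subseteq> pverts G \<and>
     (\<forall>i < length vs. \<forall>j < length vs.
        (vs ! i, vs ! j) \<in> parcs G \<longleftrightarrow>
          j = Suc i mod length vs \<or> i = Suc j mod length vs)"

definition chordal :: "'a pair_pre_digraph \<Rightarrow> bool" where
  "chordal G \<longleftrightarrow> \<not> (\<exists>vs. induced_cycle G vs \<and> length vs \<ge> 4)"

end

theory Submission
  imports Defs "HOL-Number_Theory.Cong"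
begin

text \<open>
  Let \<open>e\<^sub>0, \<dots>, e\<^bsub>n-1\<^esub>\<close> be an induced cycle of length \<open>n \<ge> 4\<close> in the conflict graph. Two consecutive
  edges of this cycle cannot both come from equal heads, nor both from antiparallel arcs, since
  either would make \<open>e\<^sub>i\<close> and \<open>e\<^bsub>i+2\<^esub>\<close> share their head. So the two kinds of conflicts alternate,
  \<open>n = 2 * k\<close> is even, and every second arc \<open>e\<^sub>0, e\<^sub>2, e\<^sub>4, \<dots>\<close> starts where the preceding one ends.
  These arcs form a directed cycle of length \<open>k\<close>. If \<open>k = 2\<close>, then \<open>e\<^sub>0\<close> and \<open>e\<^sub>2\<close> are antiparallel,
  hence a chord; so \<open>k \<ge> 3\<close>, contradicting 2-acyclicity.
\<close>

text \<open>The cycle consists of the ranges of \<open>v\<close> and \<open>a\<close>. Since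
  \<open>v\<close> repeats only at indices congruent modulo \<open>k\<close>, an arc is determined
  by its tail and also by its head, which gives both the degrees and the absence of parallel
  arcs.\<close>

lemma directed_cycle_of_periodic_walk:
  fixes D :: "('a, 'b) pre_digraph" and a :: "nat \<Rightarrow> 'b" and v :: "nat \<Rightarrow> 'a"
  assumes "fin_digraph D" and "k > 0"
    and a: "\<And>i. a i \<in> arcs D" and tl: "\<And>i. tail D (a i) = v i"
    and hd: "\<And>i. head D (a i) = v (Suc i)"
    and v: "\<And>i j. v i = v j \<longleftrightarrow> i mod k = j mod k"
    and per: "\<And>i j. i mod k = j mod k \<Longrightarrow> a i = a j"
  shows "\<exists>C. subgraph C D \<and> directed_cycle C \<and> card (verts C) = k"
proof -
  interpret fin_digraph D by fact
  let ?C = "\<lparr>verts = range v, arcs = range a, tail = tail D, head = head D\<rparr>"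
  have v_range: "range v = v ` {..<k}"
  proof -
    have "v i \<in> v ` {..<k}" for i
      using v[of i "i mod k"] \<open>k > 0\<close> by (metis imageI lessThan_iff mod_less_divisor mod_mod_trivial)
    then show ?thesis by auto
  qed
  have "inj_on v {..<k}"
    by (auto simp: inj_on_def v)
  then have card: "card (range v) = k"
    by (simp add: v_range card_image)
  have v_verts: "range v \<subseteq> verts D"
    using a tl by (metis image_subset_iff tail_in_verts)
  have a_arcs: "range a \<subseteq> arcs D" using a by auto
  interpret C: fin_digraph ?C
    using v_verts a_arcs finite_subset[OF v_verts] finite_subset[OF a_arcs]
    by unfold_locales (auto simp: tl hd)
  have sub: "subgraph ?C D"
    using v_verts a_arcs C.wf_digraph_axioms wf_digraph_axioms
    by (auto simp: subgraph_def compatible_def)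
  have a_tail: "a i = a j \<longleftrightarrow> v i = v j" for i j
    using tl v per by metis
  have a_head: "a i = a j \<longleftrightarrow> v (Suc i) = v (Suc j)" for i j
  proof -
    have "Suc i mod k = Suc j mod k \<longleftrightarrow> i mod k = j mod k"
      using cong_add_rcancel_nat[of i 1 j k] by (simp add: cong_def)
    then show ?thesis by (simp add: a_tail v)
  qed
  have nomulti: "nomulti_digraph ?C"
    by unfold_locales (auto simp: arc_to_ends_def tl a_tail)
  have step: "v i \<rightarrow>\<^sup>*\<^bsub>?C\<^esub> v (i + m)" for i m
  proof (induction m)
    case 0
    show ?case by (simp add: C.reachable_refl)
  next
    case (Suc m)
    have "v (i + m) \<rightarrow>\<^bsub>?C\<^esub> v (Suc (i + m))"
      by (auto simp: arcs_ends_conv image_iff tl hd)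
    then have "v (i + m) \<rightarrow>\<^sup>*\<^bsub>?C\<^esub> v (Suc (i + m))" by (rule C.reachable_adjI)
    with Suc.IH show ?case using C.reachable_trans by (metis add_Suc_right)
  qed
  have reach: "v i \<rightarrow>\<^sup>*\<^bsub>?C\<^esub> v j" for i j
  proof -
    \<comment> \<open>Walks only lead to larger indices, so \<open>j\<close> is replaced by a
      congruent index that is at least \<open>i\<close>.\<close>
    have "i \<le> j + i * k" using \<open>k > 0\<close> by (simp add: trans_le_add2)
    then have "v i \<rightarrow>\<^sup>*\<^bsub>?C\<^esub> v (j + i * k)"
      using step[of i "j + i * k - i"] by simp
    moreover have "v (j + i * k) = v j" by (simp add: v)
    ultimately show ?thesis by simp
  qed
  have conn: "connected ?C"
    unfolding connected_def strongly_connected_def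
    using reach by (auto intro!: C.reachable_mk_symmetricI)
  have "in_arcs ?C (v (Suc i)) = {a i}" and "out_arcs ?C (v i) = {a i}" for i
    by (auto simp: in_arcs_def out_arcs_def hd tl) (use a_head a_tail in auto)
  note deg = this
  have pred: "\<exists>j. v i = v (Suc j)" for i
    \<comment> \<open>Adding a full period before stepping back avoids truncated subtraction at
      \<open>i = 0\<close>.\<close>
    using \<open>k > 0\<close> by (intro exI[of _ "i + k - 1"]) (simp add: v)
  have "in_degree ?C (v i) = 1 \<and> out_degree ?C (v i) = 1" for i
    using deg pred[of i] by (auto simp: in_degree_def out_degree_def)
  then have "directed_cycle ?C"
    using nomulti conn C.fin_digraph_axioms by (auto simp: directed_cycle_def)
  then show ?thesis using sub card by (metis pre_digraph.select_convs(1))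
qed

text \<open>Indexing by all naturals turns cyclic positions into congruences modulo
  \<open>n\<close>. The assumption \<open>start\<close> fixes the phase of the alternation: equal
  heads occur exactly from even to odd indices.\<close>

lemma directed_cycle_of_conflict_cycle:
  fixes D :: "('a, 'b) pre_digraph" and f :: "nat \<Rightarrow> 'b"
  assumes D: "fin_digraph D" and n: "n \<ge> 4"
    and arcs: "\<And>i. f i \<in> arcs D"
    and inj: "\<And>i j. f i = f j \<longleftrightarrow> i mod n = j mod n"
    and adj: "\<And>i j. (f i, f j) \<in> parcs (tree_conflict_graph D) \<longleftrightarrow>
                j mod n = Suc i mod n \<or> i mod n = Suc j mod n"
    and start: "head D (f 0) = head D (f 1)"
  shows "\<exists>C. subgraph C D \<and> directed_cycle C \<and> card (verts C) \<ge> 3"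
proof -
  have adj': "i mod n \<noteq> j mod n \<Longrightarrow>
      (head D (f i) = head D (f j) \<or> {tail D (f i), head D (f i)} = {tail D (f j), head D (f j)})
      \<longleftrightarrow> j mod n = Suc i mod n \<or> i mod n = Suc j mod n" for i j
    using adj[of i j] inj[of i j] arcs by (auto simp: tree_conflict_graph_def)
  have shift: "(i + d) mod n = i mod n \<longleftrightarrow> n dvd d" for i d
    using mod_eq_dvd_iff_nat[of i "i + d" n] by simp
  have next_cong: "Suc i mod n \<noteq> i mod n" for i
    using shift[of i 1] n by auto
  have consec: "head D (f i) = head D (f (Suc i)) \<or>
      {tail D (f i), head D (f i)} = {tail D (f (Suc i)), head D (f (Suc i))}" for i
    using adj'[of i "Suc i"] next_cong[of i] by simp
  \<comment> \<open>Here \<open>n \<ge> 4\<close> enters: neither 2 nor 3 is a multiple of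
    \<open>n\<close>, so positions \<open>i\<close> and \<open>i + 2\<close> are distinct and not
    adjacent on the cycle.\<close>
  have skip: "i mod n \<noteq> (i + 2) mod n \<and> head D (f i) \<noteq> head D (f (i + 2)) \<and>
      {tail D (f i), head D (f i)} \<noteq> {tail D (f (i + 2)), head D (f (i + 2))}" for i
  proof -
    have "(i + 2) mod n \<noteq> i mod n" and "(i + 3) mod n \<noteq> i mod n"
      using shift[of i 2] shift[of i 3] n by (auto dest: dvd_imp_le)
    moreover have "(i + 2) mod n \<noteq> Suc i mod n"
      using next_cong[of "Suc i"] by simp
    ultimately show ?thesis using adj'[of i "i + 2"]
      by (metis One_nat_def Suc_1 add_Suc_right numeral_3_eq_3)
  qed
  \<comment> \<open>If the head changes at both steps, both pairs of arcs are reversed, and the head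
    of \<open>f i\<close> is the tail of \<open>f (i + 1)\<close> and thus the head of
    \<open>f (i + 2)\<close>.\<close>
  have alternate: "head D (f (Suc i)) = head D (f (Suc (Suc i))) \<longleftrightarrow>
      head D (f i) \<noteq> head D (f (Suc i))" for i
    using skip[of i] consec[of i] consec[of "Suc i"] by (auto simp: doubleton_eq_iff)
  have parity: "head D (f i) = head D (f (Suc i)) \<longleftrightarrow> even i" for i
    by (induction i) (use start alternate in auto)
  have "f n = f 0" and "f (Suc n) = f 1"
    using inj[of n 0] inj[of "Suc n" 1] shift[of 1 n] by simp_all
  then have "even n" using parity[of n] start by simp
  then obtain k where k: "n = 2 * k" by (elim evenE)
  \<comment> \<open>This is the common head of \<open>f (2 * i)\<close> and
    \<open>f (2 * i + 1)\<close>; the latter arc is antiparallel to \<open>f (2 * i + 2)\<close>,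
    which therefore starts at \<open>v i\<close>.\<close>
  define v where "v i = head D (f (2 * i))" for i
  have head_odd: "head D (f (Suc (2 * i))) = v i" for i
    using parity[of "2 * i"] by (simp add: v_def)
  have tail_even: "tail D (f (2 * Suc i)) = v i" for i
    using parity[of "Suc (2 * i)"] consec[of "Suc (2 * i)"] head_odd[of i]
    by (auto simp: doubleton_eq_iff v_def)
  have double: "(2 * i) mod n = (2 * j) mod n \<longleftrightarrow> i mod k = j mod k" for i j
    by (simp add: k flip: mult_mod_right)
  have v: "v i = v j \<longleftrightarrow> i mod k = j mod k" for i j
  proof
    \<comment> \<open>Arcs \<open>f (2 * i)\<close> and \<open>f (2 * j)\<close> with a common head
      are equal or adjacent. Adjacency would make an even index congruent to an odd one, impossible
      for even \<open>n\<close>.\<close>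
    have odd_even: "2 * l mod n \<noteq> Suc (2 * m) mod n" for l m
    proof
      assume "2 * l mod n = Suc (2 * m) mod n"
      then have "2 * l mod n mod 2 = Suc (2 * m) mod n mod 2" by simp
      then show False by (simp add: k mod_mod_cancel)
    qed
    assume "v i = v j"
    then show "i mod k = j mod k"
      using adj'[of "2 * i" "2 * j"] odd_even double by (auto simp: v_def)
  next
    assume "i mod k = j mod k"
    then have "f (2 * i) = f (2 * j)" by (simp add: inj double)
    then show "v i = v j" by (simp add: v_def)
  qed
  have "k \<noteq> 2"
  proof
    assume "k = 2"
    then have "v 0 = v 2" by (simp add: v)
    then have "f 0 = f 4" using inj k \<open>k = 2\<close> by simp
    moreover have "tail D (f 2) = head D (f 0)" and "tail D (f 4) = head D (f 2)"
      using tail_even[of 0] tail_even[of 1] by (simp_all add: v_def)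
    ultimately have "{tail D (f 2), head D (f 2)} = {tail D (f 0), head D (f 0)}"
      by auto
    then show False using skip[of 0] by (simp add: numeral_2_eq_2)
  qed
  then have "k \<ge> 3" using n k by simp
  moreover have "\<exists>C. subgraph C D \<and> directed_cycle C \<and> card (verts C) = k"
  \<comment> \<open>The arc leaving \<open>v i\<close> is \<open>f (2 * Suc i)\<close>, as
    \<open>f (2 * i)\<close> ends there; hence the shift.\<close>
  proof (rule directed_cycle_of_periodic_walk[OF D, of k "\<lambda>i. f (2 * Suc i)" v])
    show "head D (f (2 * Suc i)) = v (Suc i)" for i by (simp add: v_def)
    show "f (2 * Suc i) = f (2 * Suc j)" if "i mod k = j mod k" for i j
      using that by (metis double inj mod_Suc_eq)
  qed (use \<open>k \<ge> 3\<close> arcs tail_even v in auto)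
  ultimately show ?thesis by blast
qed

theorem theorem4p3:
  fixes D :: "('a, 'b) pre_digraph"
  assumes "fin_digraph D"
    and "two_acyclic D"
  shows "chordal (tree_conflict_graph D)"
  unfolding chordal_def
proof
  assume "\<exists>vs. induced_cycle (tree_conflict_graph D) vs \<and> length vs \<ge> 4"
  then obtain vs where ind: "induced_cycle (tree_conflict_graph D) vs" and n: "length vs \<ge> 4"
    by blast
  define n where "n = length vs"
  define f where "f i = vs ! (i mod n)" for i
  have "n > 0" "n \<ge> 4" using n by (auto simp: n_def)
  have dist: "distinct vs" and sub: "set vs \<subseteq> arcs D"
    using ind by (auto simp: induced_cycle_def tree_conflict_graph_def)
  have arcs: "f i \<in> arcs D" for i
    using sub \<open>n > 0\<close> by (auto simp: f_def n_def intro!: subsetD[OF sub] nth_mem)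
  have inj: "f i = f j \<longleftrightarrow> i mod n = j mod n" for i j
    using dist \<open>n > 0\<close> by (simp add: f_def n_def nth_eq_iff_index_eq)
  have "(f i, f j) \<in> parcs (tree_conflict_graph D) \<longleftrightarrow>
      j mod n = Suc (i mod n) mod n \<or> i mod n = Suc (j mod n) mod n" for i j
    using ind \<open>n > 0\<close> unfolding induced_cycle_def f_def n_def by simp
  then have adj: "(f i, f j) \<in> parcs (tree_conflict_graph D) \<longleftrightarrow>
      j mod n = Suc i mod n \<or> i mod n = Suc j mod n" for i j
    by (simp only: mod_Suc_eq)
  have suc: "Suc i mod n = Suc j mod n \<longleftrightarrow> i mod n = j mod n" for i j
    using cong_add_rcancel_nat[of i 1 j n] by (simp add: cong_def)
  have "\<exists>C. subgraph C D \<and> directed_cycle C \<and> card (verts C) \<ge> 3"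
  proof (cases "head D (f 0) = head D (f 1)")
    case True
    with directed_cycle_of_conflict_cycle[OF assms(1) \<open>n \<ge> 4\<close> arcs inj adj] show ?thesis by simp
  next
    case False
    \<comment> \<open>By alternation the second conflict has equal heads, so the sequence started at
      \<open>f 1\<close> has the required phase. Otherwise \<open>f 0\<close> and \<open>f 2\<close>
      would form a chord.\<close>
    have "head D (f 1) = head D (f 2)"
    proof (rule ccontr)
      assume "head D (f 1) \<noteq> head D (f 2)"
      moreover have "(f 0, f 1) \<in> parcs (tree_conflict_graph D)"
        "(f 1, f 2) \<in> parcs (tree_conflict_graph D)"
        by (simp_all add: adj numeral_2_eq_2)
      ultimately have "head D (f 0) = head D (f 2)"
        using False by (auto simp: tree_conflict_graph_def doubleton_eq_iff)
      moreover have "f 0 \<noteq> f 2" using \<open>n \<ge> 4\<close> by (simp add: inj)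
      ultimately have "(f 0, f 2) \<in> parcs (tree_conflict_graph D)"
        using arcs by (simp add: tree_conflict_graph_def)
      then show False using \<open>n \<ge> 4\<close> by (cases "n = 3") (auto simp: adj)
    qed
    then show ?thesis
      using \<open>n \<ge> 4\<close> arcs
      by (intro directed_cycle_of_conflict_cycle[OF assms(1), of n "\<lambda>i. f (Suc i)"])
        (simp_all add: inj adj suc numeral_2_eq_2)
  qed
  then show False using assms(2) by (auto simp: two_acyclic_def)
qed

end
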